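(* For $d\in\mathbb N$ let $q^d(t)=\sum_{i=0}^d 2^{2^i}t^i$, and let $Z=\{(d,x)\in\mathbb N\times\mathbb C : q^d(x)=0\}$. The set $Z$ cannot be decided uniformly in time polylogarithmic in $d$. That is, there do not exist constants $a,b>0$ and a single machine $M$ over $\mathbb C$ which, on every input $(d,x)$ with $d\ge 2$ an integer (given in binary notation) and $x\in\mathbb C$, decides whether $q^d(x)=0$ in time at most $a(\log d)^b$.
   Context: Here $q^d$ denotes a polynomial indexed by $d$ (the superscript is not a power). A machine over $\mathbb C$ is a machine in the sense of Blum, Cucker, Shub and Smale: it has finitely many complex constants (fixed once and for all, independently of the input), takes as input a finite sequence of complex numbers, performs one arithmetic operation ($+,-,\times,\div$), one test for equality to zero (with branching), or one data-movement operation per step, and its running time on an input is the number of steps until it halts with answer YES or NO. The input $(d,x)$ consists of the binary digits of $d$ (each digit $0$ or $1$ being stored as a complex number) together with the complex number $x$. The same machine must be used for all values of $d$ (uniform setting). Equivalently, the size of the input $(d,x)$ is of order $\log d$, and the statement says that $Z$ is not in the class $\mathcal P$ (deterministic polynomial time) over $\mathbb C$. *)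

theory Defs
  imports Complex_Main "HOL-Computational_Algebra.Polynomial"
begin

text \<open>
  Machines over the complex numbers in the sense of Blum, Cucker, Shub and Smale.  The memory is a
  two-way infinite sequence of complex numbers.  Instructions address fixed cells, and the shift
  instructions move the whole sequence by one place, which gives access to inputs of any length.
  A machine is a finite program, so it has finitely many constants, namely those occurring in
  \<open>Load\<close> instructions.
\<close>

type_synonym tape = "int \<Rightarrow> complex"

datatype instr =
    Load int complex
  | Copy int int
  | Add int int int
  | Sub int int int
  | Mul int int int
  | Div int int int
  | ShiftLeft
  | ShiftRight
  | BranchZero int nat nat
  | AnswerYes
  | AnswerNo

type_synonym machine = "instr list"

datatype state = Running nat tape | Halted bool | Failed

text \<open>
  Division by zero and jumps out of the program lead to \<open>Failed\<close>, which never becomes an answer;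
  in particular the library convention \<open>z / 0 = 0\<close> is not available to machines.
\<close>

fun exec :: "instr \<Rightarrow> nat \<Rightarrow> tape \<Rightarrow> state" where
  "exec (Load i c) pc s = Running (Suc pc) (s(i := c))"
| "exec (Copy i j) pc s = Running (Suc pc) (s(i := s j))"
| "exec (Add i j k) pc s = Running (Suc pc) (s(i := s j + s k))"
| "exec (Sub i j k) pc s = Running (Suc pc) (s(i := s j - s k))"
| "exec (Mul i j k) pc s = Running (Suc pc) (s(i := s j * s k))"
| "exec (Div i j k) pc s =
     (if s k = 0 then Failed else Running (Suc pc) (s(i := s j / s k)))"
| "exec ShiftLeft pc s = Running (Suc pc) (\<lambda>i. s (i + 1))"
| "exec ShiftRight pc s = Running (Suc pc) (\<lambda>i. s (i - 1))"
| "exec (BranchZero j l m) pc s = Running (if s j = 0 then l else m) s"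
| "exec AnswerYes pc s = Halted True"
| "exec AnswerNo pc s = Halted False"

fun step :: "machine \<Rightarrow> state \<Rightarrow> state" where
  "step M (Running pc s) = (if pc < length M then exec (M ! pc) pc s else Failed)"
| "step M (Halted b) = Halted b"
| "step M Failed = Failed"

text \<open>
  The input \<open>w\<close> of length \<open>n\<close> is placed in cells \<open>1, \<dots>, n\<close>.  As in Blum, Cucker, Shub and Smale,
  its length is given in unary by ones in cells \<open>0, -1, \<dots>, 1 - n\<close>, so that a machine can detect
  the end of the input; all other cells are zero.
\<close>

definition input_tape :: "complex list \<Rightarrow> tape" where
  "input_tape w i =
     (if 1 \<le> i \<and> i \<le> int (length w) then w ! nat (i - 1)
      else if 1 - int (length w) \<le> i \<and> i \<le> 0 then 1
      else 0)"

definition run :: "machine \<Rightarrow> complex list \<Rightarrow> nat \<Rightarrow> state" where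
  "run M w n = (step M ^^ n) (Running 0 (input_tape w))"

definition answers_in_time :: "machine \<Rightarrow> complex list \<Rightarrow> bool \<Rightarrow> real \<Rightarrow> bool" where
  "answers_in_time M w b t \<longleftrightarrow> (\<exists>n. real n \<le> t \<and> run M w n = Halted b)"

text \<open>Most significant digit first, without leading zeros.\<close>

fun binary_digits :: "nat \<Rightarrow> nat list" where
  "binary_digits n = (if n = 0 then [] else binary_digits (n div 2) @ [n mod 2])"

declare binary_digits.simps [simp del]

definition encode :: "nat \<Rightarrow> complex \<Rightarrow> complex list" where
  "encode d x = map of_nat (binary_digits d) @ [x]"

definition q :: "nat \<Rightarrow> complex poly" where
  "q d = (\<Sum>i=0..d. monom (2 ^ (2 ^ i)) i)"

definition zero_set :: "(nat \<times> complex) set" where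
  "zero_set = {(d, x). poly (q d) x = 0}"

end

theory Submission
  imports Defs "HOL-Computational_Algebra.Fundamental_Theorem_Algebra" "HOL-Real_Asymp.Real_Asymp"
begin

text \<open>
  Fix a machine with constants \<open>c\<^sub>1, \<dots>, c\<^sub>k\<close> that decides \<open>q d x = 0\<close> within \<open>T\<close> steps for all \<open>x\<close>, and
  run it on an indeterminate \<open>x = X\<close>.  Every cell then holds a quotient of polynomials in
  \<open>\<int>[c\<^sub>1, \<dots>, c\<^sub>k][X]\<close>, and every test is decided by whether a numerator is the zero polynomial.  An
  actual \<open>x\<close> follows this generic path unless it is a root of one of the nonzero numerators that are
  tested or divided by; let \<open>F\<close> be their product.  The generic answer is NO, so all roots of \<open>q d\<close> are
  roots of \<open>F\<close>, and by the Nullstellensatz \<open>q d\<close> divides \<open>F ^ d\<close> (\<open>decision_multiple\<close>).  Sizes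
  at most square (up to a factor 2) in each step, so \<open>F\<close> is given by an integer polynomial in
  \<open>c\<^sub>1, \<dots>, c\<^sub>k, X\<close> of weight \<open>2 ^ 2 ^ (T + 1)\<close>, where the weight is the sum of the absolute values of
  the coefficients, with a factor 2 for each occurrence of a \<open>c\<^sub>i\<close> or of \<open>X\<close>.

  The constants may be transcendental, or may satisfy relations, so the weight does not bound the
  size of the coefficients of \<open>F\<close> from below.  They are therefore eliminated one at a time
  (\<open>eliminate_constants\<close>), replacing a nonzero multiple of \<open>q d\<close> of weight \<open>W\<close> by another one of weight
  \<open>W ^ K\<close>, where \<open>K\<close> depends on the constants only.  Write the multiple as \<open>G(c)\<close>, where the
  coefficients of \<open>G\<close> do not involve \<open>c\<close>.  If \<open>c\<close> is transcendental over the remaining constants, then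
  each coefficient of \<open>G\<close> is a multiple of \<open>q d\<close>, because reducing modulo \<open>q d\<close> commutes with evaluating at
  \<open>c\<close>.  If \<open>c\<close> is a root of a polynomial \<open>m\<close> of minimal degree, then pseudo-division of \<open>G\<close> by \<open>m\<close>, and
  then of \<open>m\<close> by the remainders, lowers the degree in \<open>c\<close> down to 0; each remainder takes at \<open>c\<close> a
  nonzero value that is a multiple of \<open>G(c)\<close>.

  What is left is a nonzero integer multiple of \<open>q d\<close> with coefficients at most \<open>2 ^ (2 ^ (T + 1) * d * K)\<close>.
  Since \<open>q d / 2\<close> is primitive, Gauss' lemma makes the leading coefficient of the multiple divisible
  by \<open>2 ^ (2 ^ d - 1)\<close>.  Hence \<open>2 ^ d - 1 \<le> 2 ^ (T + 1) * d * K\<close> (\<open>running_time_lower_bound\<close>), which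
  a polylogarithmic \<open>T\<close> violates for large \<open>d\<close>.
\<close>

section \<open>Weights on integral domains and their extension to polynomials\<close>

text \<open>
  \<open>P a H\<close> is read as: \<open>a\<close> has a representation of weight at most \<open>H\<close>.  Such a relation behaves like the
  statement that a submultiplicative norm of \<open>a\<close> is at most \<open>H\<close>, except that elements without any weight are
  allowed; those that have one form a subring.  Weights are natural numbers, so a nonzero
  element has weight at least 1.
\<close>

locale weighting =
  fixes P :: "'a::idom \<Rightarrow> nat \<Rightarrow> bool"
  assumes zero: "P 0 0"
    and one: "P 1 1"
    and uminus: "P a H \<Longrightarrow> P (- a) H"
    and add: "P a H \<Longrightarrow> P b H' \<Longrightarrow> P (a + b) (H + H')"
    and mult: "P a H \<Longrightarrow> P b H' \<Longrightarrow> P (a * b) (H * H')"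
    and mono: "P a H \<Longrightarrow> H \<le> H' \<Longrightarrow> P a H'"
    and pos: "P a 0 \<Longrightarrow> a = 0"

text \<open>
  The weight of a polynomial is the sum of the weights of its coefficients, the indeterminate
  counting with weight 2.  The weights of the coefficients are collected in a polynomial \<open>h\<close>, which
  is evaluated at 2, so that sums and products of weights are those of \<open>h\<close>.  The value 2 makes
  the weight bound the degree as well: it is at least \<open>2 ^ degree G\<close>.
\<close>

definition lift :: "('a::zero \<Rightarrow> nat \<Rightarrow> bool) \<Rightarrow> 'a poly \<Rightarrow> nat \<Rightarrow> bool" where
  "lift P G H \<longleftrightarrow> (\<exists>h::nat poly. (\<forall>i. P (coeff G i) (coeff h i)) \<and> poly h 2 \<le> H)"

lemma coeff_weight_le_poly_2: "coeff h i * 2 ^ i \<le> poly h (2::nat)"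
proof (cases "i \<le> degree h")
  case True
  then show ?thesis
    unfolding poly_altdef by (intro member_le_sum) auto
qed (simp add: coeff_eq_0)

lemma liftI_pCons:
  assumes "lift P G H" "P a H'"
  shows "lift P (pCons a G) (H' + 2 * H)"
proof -
  from assms(1) obtain h where h: "\<And>i. P (coeff G i) (coeff h i)" "poly h 2 \<le> H"
    by (auto simp: lift_def)
  show ?thesis
    unfolding lift_def
    by (rule exI[of _ "pCons H' h"]) (use h assms(2) in \<open>auto simp: coeff_pCons split: nat.split\<close>)
qed

context weighting
begin

lemma sum: "finite I \<Longrightarrow> (\<And>i. i \<in> I \<Longrightarrow> P (a i) (h i)) \<Longrightarrow> P (sum a I) (sum h I)"
  by (induction I rule: finite_induct) (auto intro: zero add)

lemma power: "P a H \<Longrightarrow> P (a ^ n) (H ^ n)"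
proof (induction n)
  case 0
  then show ?case using one by simp
next
  case (Suc n)
  then show ?case using mult[of a H] by simp
qed

lemma diff: "P a H \<Longrightarrow> P b H' \<Longrightarrow> P (a - b) (H + H')"
  using add[OF _ uminus, of a H b H'] by simp

lemma lift_zero: "lift P 0 0"
  unfolding lift_def by (rule exI[of _ 0]) (simp add: zero)

lemma lift_const: "P a H \<Longrightarrow> lift P [:a:] H"
  using liftI_pCons[OF lift_zero, of a H] by simp

lemma lift_X: "lift P [:0, 1:] 2"
  using liftI_pCons[OF lift_const[OF one] zero] by (simp add: numeral_2_eq_2)

lemma lift_exI:
  assumes "\<And>i. \<exists>H. P (coeff G i) H"
  shows "\<exists>H. lift P G H"
  using assms
proof (induction G)
  case 0
  then show ?case using lift_zero by blast
next
  case (pCons a G)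
  have "\<exists>H. P (coeff G i) H" for i
    using pCons.prems[of "Suc i"] by simp
  then obtain H where "lift P G H" using pCons.IH by blast
  moreover obtain H' where "P a H'" using pCons.prems[of 0] by auto
  ultimately show ?case using liftI_pCons by blast
qed

lemma coeff_weight:
  assumes "lift P G H"
  shows "\<exists>H'. P (coeff G i) H' \<and> H' * 2 ^ i \<le> H"
  using assms coeff_weight_le_poly_2 unfolding lift_def by (meson le_trans)

lemma coeff_weight': "lift P G H \<Longrightarrow> P (coeff G i) H"
proof -
  assume "lift P G H"
  then obtain H' where "P (coeff G i) H'" "H' * 2 ^ i \<le> H"
    using coeff_weight by blast
  moreover have "H' \<le> H' * 2 ^ i" by simp
  ultimately show ?thesis using mono le_trans by blast
qed

lemma degree_weight:
  assumes "lift P G H" "G \<noteq> 0"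
  shows "2 ^ degree G \<le> H"
proof -
  obtain H' where H': "P (lead_coeff G) H'" "H' * 2 ^ degree G \<le> H"
    using coeff_weight[OF assms(1)] by blast
  have "H' \<noteq> 0"
    using H' pos assms(2) by (metis leading_coeff_0_iff)
  then have "2 ^ degree G \<le> H' * 2 ^ degree G" by simp
  with H' show ?thesis by linarith
qed

lemma weighting_lift: "weighting (lift P)"
proof
  show "lift P 0 0" by (rule lift_zero)
  show "lift P 1 1" using lift_const[OF one] by (simp add: one_pCons)
  show "lift P (- a) H" if "lift P a H" for a H
    using that unfolding lift_def by (auto intro: uminus)
  show "lift P (a + b) (H + H')" if "lift P a H" "lift P b H'" for a b H H'
  proof -
    from that obtain h h' where h: "\<And>i. P (coeff a i) (coeff h i)" "poly h 2 \<le> H"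
      "\<And>i. P (coeff b i) (coeff h' i)" "poly h' 2 \<le> H'"
      by (auto simp: lift_def)
    show ?thesis
      unfolding lift_def
      by (rule exI[of _ "h + h'"]) (use h in \<open>auto intro: add add_mono\<close>)
  qed
  show "lift P (a * b) (H * H')" if "lift P a H" "lift P b H'" for a b H H'
  proof -
    from that obtain h h' where h: "\<And>i. P (coeff a i) (coeff h i)" "poly h 2 \<le> H"
      "\<And>i. P (coeff b i) (coeff h' i)" "poly h' 2 \<le> H'"
      by (auto simp: lift_def)
    show ?thesis
      unfolding lift_def
      by (rule exI[of _ "h * h'"])
        (use h in \<open>auto simp: coeff_mult intro!: sum mult mult_mono\<close>)
  qed
  show "lift P a H'" if "lift P a H" "H \<le> H'" for a H H'
    using that unfolding lift_def by (meson le_trans)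
  show "a = 0" if "lift P a 0" for a
    using degree_weight[OF that] by fastforce
qed

text \<open>
  Pseudo-division with weights: each step replaces \<open>A\<close> by a combination of \<open>A\<close> and \<open>B\<close> of smaller
  degree and multiplies the weight by at most \<open>2 * HB\<close>.  For the quotient it is enough that
  it has some weight.
\<close>

lemma pseudo_remainder:
  assumes B: "lift P B HB" "degree B > 0" and A: "lift P A HA"
  shows "\<exists>k Q R HQ. smult (lead_coeff B ^ k) A = Q * B + R \<and> degree R < degree B
           \<and> lift P Q HQ \<and> lift P R (HA * (2 * HB) ^ Suc (degree A))"
  using A
proof (induction "degree A" arbitrary: A HA rule: less_induct)
  case less
  interpret L: weighting "lift P" by (rule weighting_lift)
  have HB: "HB \<ge> 1"
    using degree_weight[OF B(1)] B(2) by (metis degree_0 less_irrefl le_trans one_le_numeral one_le_power)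
  show ?case
  proof (cases "degree A < degree B")
    case True
    have "HA * 1 \<le> HA * (2 * HB) ^ Suc (degree A)"
      using HB by (intro mult_le_mono2 one_le_power) auto
    then have "lift P A (HA * (2 * HB) ^ Suc (degree A))"
      using L.mono[OF less.prems] by simp
    then show ?thesis
      using True lift_zero by (intro exI[of _ 0] exI[of _ A]) auto
  next
    case False
    define A1 where
      "A1 = smult (lead_coeff B) A - monom (lead_coeff A) (degree A - degree B) * B"
    have lcB: "lift P [:lead_coeff B:] HB"
      by (intro lift_const coeff_weight'[OF B(1)])
    \<comment> \<open>The factor \<open>2 ^ degree A\<close> in the weight of \<open>A\<close> pays for the power of the indeterminate.\<close>
    obtain H' where H': "P (lead_coeff A) H'" "H' * 2 ^ degree A \<le> HA"
      using coeff_weight[OF less.prems] by blast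
    then have "lift P ([:lead_coeff A:] * [:0, 1:] ^ (degree A - degree B))
        (H' * 2 ^ (degree A - degree B))"
      by (intro L.mult L.power lift_const lift_X)
    moreover have "[:lead_coeff A:] * [:0, 1:] ^ (degree A - degree B)
        = monom (lead_coeff A) (degree A - degree B)"
      by (simp add: monom_altdef)
    moreover have "H' * 2 ^ (degree A - degree B) \<le> HA"
      using H'(2) by (meson diff_le_self le_trans mult_le_mono2 one_le_numeral power_increasing)
    ultimately have mon: "lift P (monom (lead_coeff A) (degree A - degree B)) HA"
      using L.mono by metis
    have "lift P ([:lead_coeff B:] * A - monom (lead_coeff A) (degree A - degree B) * B)
        (HB * HA + HA * HB)"
      by (intro L.diff L.mult lcB mon B(1) less.prems)
    moreover have "HB * HA + HA * HB = 2 * HB * HA" by simp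
    ultimately have A1: "lift P A1 (2 * HB * HA)"
      by (simp add: A1_def)
    have "coeff A1 (degree A) = 0"
      using False by (simp add: A1_def coeff_monom_mult)
    moreover have "degree A1 \<le> degree A"
      unfolding A1_def
      by (intro degree_diff_le order.trans[OF degree_smult_le] order.trans[OF degree_mult_le])
        (use False in \<open>auto intro: order.trans[OF add_mono[OF degree_monom_le order.refl]]\<close>)
    ultimately have deg: "degree A1 < degree A"
      using False B(2) by (metis leading_coeff_0_iff degree_0 le_neq_implies_less not_less)
    from less.hyps[OF deg A1] obtain k Q R HQ where
      R: "smult (lead_coeff B ^ k) A1 = Q * B + R" "degree R < degree B" "lift P Q HQ"
         "lift P R (2 * HB * HA * (2 * HB) ^ Suc (degree A1))" by blast
    have "smult (lead_coeff B ^ Suc k) A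
        = smult (lead_coeff B ^ k) (A1 + monom (lead_coeff A) (degree A - degree B) * B)"
      by (simp add: A1_def mult.commute)
    also have "\<dots> = (Q + [:lead_coeff B:] ^ k * monom (lead_coeff A) (degree A - degree B)) * B + R"
      by (simp add: smult_add_right R(1) algebra_simps poly_const_pow)
    finally have eq: "smult (lead_coeff B ^ Suc k) A
        = (Q + [:lead_coeff B:] ^ k * monom (lead_coeff A) (degree A - degree B)) * B + R" .
    have "2 * HB * HA * (2 * HB) ^ Suc (degree A1) = HA * (2 * HB) ^ Suc (Suc (degree A1))"
      by simp
    also have "\<dots> \<le> HA * (2 * HB) ^ Suc (degree A)"
      using deg HB by (intro mult_le_mono2 power_increasing) auto
    finally have "lift P R (HA * (2 * HB) ^ Suc (degree A))"
      using L.mono R(4) by blast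
    moreover have "lift P (Q + [:lead_coeff B:] ^ k * monom (lead_coeff A) (degree A - degree B))
        (HQ + HB ^ k * HA)"
      by (intro L.add L.mult L.power R(3) mon lcB)
    ultimately show ?thesis using eq R(2) by blast
  qed
qed

end

section \<open>Polynomials over the ring generated by finitely many constants\<close>

text \<open>The weight of an integer is its absolute value; other complex numbers have none.\<close>

definition int_weight :: "complex \<Rightarrow> nat \<Rightarrow> bool" where
  "int_weight z H \<longleftrightarrow> (\<exists>n. z = of_int n \<and> \<bar>n\<bar> \<le> int H)"

text \<open>
  Weights for the elements of \<open>\<int>[c\<^sub>1, \<dots>, c\<^sub>k][X]\<close>, as a subring of \<open>\<complex>[X]\<close>, where \<open>cs = [c\<^sub>1, \<dots>, c\<^sub>k]\<close>.  An element is
  represented as a polynomial expression in the first constant, over the ring of the others, and the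
  weight of the representation is used.  Representations need not be unique, because the constants
  need not be algebraically independent.
\<close>

fun poly_weight :: "complex list \<Rightarrow> complex poly \<Rightarrow> nat \<Rightarrow> bool" where
  "poly_weight [] p H \<longleftrightarrow> lift int_weight p H"
| "poly_weight (c # cs) p H \<longleftrightarrow> (\<exists>G. poly G [:c:] = p \<and> lift (poly_weight cs) G H)"

lemma weighting_int_weight: "weighting int_weight"
proof
  show "int_weight (a + b) (H + H')" if "int_weight a H" "int_weight b H'" for a b H H'
  proof -
    from that obtain n n' where "a = of_int n" "b = of_int n'" "\<bar>n\<bar> \<le> int H" "\<bar>n'\<bar> \<le> int H'"
      by (auto simp: int_weight_def)
    then show ?thesis
      unfolding int_weight_def by (intro exI[of _ "n + n'"]) auto
  qed
  show "int_weight (a * b) (H * H')" if "int_weight a H" "int_weight b H'" for a b H H'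
  proof -
    from that obtain n n' where "a = of_int n" "b = of_int n'" "\<bar>n\<bar> \<le> int H" "\<bar>n'\<bar> \<le> int H'"
      by (auto simp: int_weight_def)
    then show ?thesis
      unfolding int_weight_def by (intro exI[of _ "n * n'"]) (auto simp: abs_mult intro: mult_mono)
  qed
  show "int_weight (- a) H" if "int_weight a H" for a H
    using that unfolding int_weight_def by (metis abs_minus_cancel of_int_minus)
qed (force simp: int_weight_def)+

lemma weighting_poly_weight: "weighting (poly_weight cs)"
proof (induction cs)
  case Nil
  have "poly_weight [] = lift int_weight" by (intro ext) simp
  then show ?case
    using weighting.weighting_lift[OF weighting_int_weight] by simp
next
  case (Cons c cs)
  interpret L: weighting "lift (poly_weight cs)"
    by (rule weighting.weighting_lift[OF Cons.IH])
  show ?case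
  proof
    show "poly_weight (c # cs) 0 0"
      using L.zero by (auto intro!: exI[of _ 0])
    show "poly_weight (c # cs) 1 1"
      using L.one by (auto intro!: exI[of _ 1])
    show "poly_weight (c # cs) (- a) H" if "poly_weight (c # cs) a H" for a H
      using that L.uminus by (auto simp flip: poly_minus)
    show "poly_weight (c # cs) (a + b) (H + H')"
      if "poly_weight (c # cs) a H" "poly_weight (c # cs) b H'" for a b H H'
      using that L.add by (auto simp flip: poly_add)
    show "poly_weight (c # cs) (a * b) (H * H')"
      if "poly_weight (c # cs) a H" "poly_weight (c # cs) b H'" for a b H H'
      using that L.mult by (auto simp flip: poly_mult)
    show "poly_weight (c # cs) a H'" if "poly_weight (c # cs) a H" "H \<le> H'" for a H H'
      using that L.mono by auto
    show "a = 0" if "poly_weight (c # cs) a 0" for a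
      using that L.pos by force
  qed
qed

lemma poly_weight_Cons:
  assumes "poly_weight cs p H"
  shows "poly_weight (c # cs) p H"
  using weighting.lift_const[OF weighting_poly_weight assms]
  by (auto intro!: exI[of _ "[:p:]"])

lemma poly_weight_X: "poly_weight cs [:0, 1:] 2"
proof (induction cs)
  case Nil
  interpret weighting int_weight by (rule weighting_int_weight)
  show ?case using lift_X by simp
qed (rule poly_weight_Cons)

lemma poly_weight_constant: "c \<in> set cs \<Longrightarrow> poly_weight cs [:c:] 2"
proof (induction cs)
  case (Cons c' cs)
  interpret weighting "poly_weight cs" by (rule weighting_poly_weight)
  show ?case
  proof (cases "c = c'")
    case True
    with lift_X show ?thesis by (auto intro!: exI[of _ "[:0, 1:]"])
  qed (use Cons poly_weight_Cons in auto)
qed auto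

abbreviation complex_poly :: "int poly \<Rightarrow> complex poly" where
  "complex_poly \<equiv> map_poly of_int"

lemma complex_poly_add: "complex_poly (p + p') = complex_poly p + complex_poly p'"
  by (intro poly_eqI) (simp add: coeff_map_poly)

lemma complex_poly_mult: "complex_poly (p * p') = complex_poly p * complex_poly p'"
  by (intro poly_eqI) (simp add: coeff_map_poly coeff_mult)

lemma complex_poly_smult: "complex_poly (smult n p) = smult (of_int n) (complex_poly p)"
  by (intro poly_eqI) (simp add: coeff_map_poly)

lemma degree_complex_poly: "degree (complex_poly p) = degree p"
  by (rule degree_map_poly) auto

lemma complex_poly_0_iff: "complex_poly p = 0 \<longleftrightarrow> p = 0"
  by (auto simp: poly_eq_iff coeff_map_poly)

lemma poly_weight_Nil_obtain:
  assumes "poly_weight [] p H"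
  obtains g where "p = complex_poly g" "\<And>i. \<bar>coeff g i\<bar> \<le> int H"
proof -
  interpret weighting int_weight by (rule weighting_int_weight)
  have "\<forall>i. \<exists>n. coeff p i = of_int n \<and> \<bar>n\<bar> \<le> int H"
    using coeff_weight' assms by (auto simp: int_weight_def)
  then obtain f where f: "\<And>i. coeff p i = of_int (f i)" "\<And>i. \<bar>f i\<bar> \<le> int H" by metis
  define g where "g = Abs_poly f"
  have "coeff g i = f i" for i
  proof -
    have "\<forall>\<^sub>\<infinity>n. f n = 0"
      unfolding MOST_nat using f(1) coeff_eq_0[of p] by (metis of_int_eq_0_iff)
    then show ?thesis unfolding g_def by (simp add: Abs_poly_inverse)
  qed
  with f show ?thesis
    by (intro that[of g]) (auto simp: poly_eq_iff coeff_map_poly)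
qed

lemma poly_weight_complex_poly: "\<exists>H. poly_weight [] (complex_poly g) H"
proof -
  interpret weighting int_weight by (rule weighting_int_weight)
  have "\<exists>H. lift int_weight (complex_poly g) H"
    by (rule lift_exI) (auto simp: int_weight_def coeff_map_poly intro!: exI[of _ "nat \<bar>coeff g _\<bar>"])
  then show ?thesis by simp
qed

lemma poly_weight_int: "\<exists>H. poly_weight cs [:of_int n:] H"
proof (induction cs)
  case Nil
  have "[:of_int n:] = complex_poly [:n:]" by (simp add: map_poly_pCons)
  then show ?case using poly_weight_complex_poly by metis
qed (use poly_weight_Cons in blast)

lemma poly_weight_smult_int:
  assumes "\<exists>H. poly_weight cs p H"
  shows "\<exists>H. poly_weight cs (smult (of_int n) p) H"
proof -
  interpret weighting "poly_weight cs" by (rule weighting_poly_weight)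
  obtain H H' where "poly_weight cs [:of_int n:] H" "poly_weight cs p H'"
    using assms poly_weight_int by blast
  then have "poly_weight cs ([:of_int n:] * p) (H * H')" by (rule mult)
  then show ?thesis by auto
qed

text \<open>Division by \<open>r\<close> introduces denominators; an integer factor clears them.\<close>

lemma complex_poly_mod:
  assumes "r \<noteq> 0"
  shows "\<exists>a m. a \<noteq> 0 \<and> smult (of_int a) (complex_poly g mod complex_poly r) = complex_poly m"
proof -
  obtain a u where a: "a \<noteq> 0" "smult a g = r * u + pseudo_mod g r"
    using pseudo_mod(1)[OF assms] by blast
  have deg: "pseudo_mod g r = 0 \<or> degree (pseudo_mod g r) < degree r"
    using pseudo_mod(2)[OF assms] .
  have "smult (of_int a) (complex_poly g mod complex_poly r)
      = complex_poly (r * u + pseudo_mod g r) mod complex_poly r"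
    by (simp add: complex_poly_smult mod_smult_left flip: a(2))
  also have "\<dots> = complex_poly (pseudo_mod g r) mod complex_poly r"
    by (simp add: complex_poly_add complex_poly_mult)
  also have "\<dots> = complex_poly (pseudo_mod g r)"
    using deg by (auto simp: mod_poly_less degree_complex_poly)
  finally show ?thesis using a(1) by blast
qed

section \<open>Elimination of the constants\<close>

lemma poly_weight_mod:
  assumes r: "r \<noteq> 0" and "poly_weight cs p H"
  shows "\<exists>a. a \<noteq> 0 \<and> (\<exists>H. poly_weight cs (smult (of_int a) (p mod complex_poly r)) H)"
  using assms(2)
proof (induction cs arbitrary: p H)
  case Nil
  then obtain g where "p = complex_poly g" using poly_weight_Nil_obtain by blast
  then show ?case
    using complex_poly_mod[OF r, of g] poly_weight_complex_poly by metis
next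
  case (Cons c cs)
  interpret weighting "poly_weight cs" by (rule weighting_poly_weight)
  interpret C: weighting "poly_weight (c # cs)" by (rule weighting_poly_weight)
  obtain G where G: "poly G [:c:] = p" "lift (poly_weight cs) G H"
    using Cons.prems by auto
  define R where "R = complex_poly r"
  \<comment> \<open>The polynomials with the claimed property are closed under addition and multiplication by \<open>c\<close>.\<close>
  define V where "V p \<longleftrightarrow> (\<exists>a. a \<noteq> 0 \<and> (\<exists>H. poly_weight (c # cs) (smult (of_int a) (p mod R)) H))"
    for p
  have V_add: "V (p + p')" if "V p" "V p'" for p p'
  proof -
    from that obtain a a' where a: "a \<noteq> 0" "\<exists>H. poly_weight (c # cs) (smult (of_int a) (p mod R)) H"
      and a': "a' \<noteq> 0" "\<exists>H. poly_weight (c # cs) (smult (of_int a') (p' mod R)) H"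
      unfolding V_def by blast
    obtain H H' where
      "poly_weight (c # cs) (smult (of_int a') (smult (of_int a) (p mod R))) H"
      "poly_weight (c # cs) (smult (of_int a) (smult (of_int a') (p' mod R))) H'"
      using poly_weight_smult_int[OF a(2)] poly_weight_smult_int[OF a'(2)] by blast
    from C.add[OF this]
    have "poly_weight (c # cs) (smult (of_int (a * a')) ((p + p') mod R)) (H + H')"
      by (simp add: poly_mod_add_left smult_add_right mult.commute)
    then show ?thesis using a(1) a'(1) unfolding V_def by (metis mult_eq_0_iff)
  qed
  have V_mult: "V ([:c:] * p)" if "V p" for p
  proof -
    from that obtain a H where a: "a \<noteq> 0" "poly_weight (c # cs) (smult (of_int a) (p mod R)) H"
      unfolding V_def by blast
    have "poly_weight (c # cs) [:c:] 2" by (rule poly_weight_constant) simp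
    from C.mult[OF this a(2)]
    have "poly_weight (c # cs) (smult (of_int a) (([:c:] * p) mod R)) (2 * H)"
      by (simp add: mod_smult_left mult.commute)
    then show ?thesis using a(1) unfolding V_def by blast
  qed
  have "V (poly G [:c:])" if "\<And>i. \<exists>H. poly_weight cs (coeff G i) H" for G
    using that
  proof (induction G)
    case 0
    show ?case
      using C.zero unfolding V_def by (intro exI[of _ 1] conjI exI[of _ 0]) (simp_all del: poly_weight.simps)
  next
    case (pCons g G)
    obtain H where "poly_weight cs g H" using pCons.prems[of 0] by auto
    then have "V g"
      using Cons.IH poly_weight_Cons unfolding V_def R_def by meson
    moreover have "V (poly G [:c:])"
      using pCons.IH pCons.prems[of "Suc _"] by auto
    ultimately show ?case using V_add V_mult by simp
  qed
  then show ?case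
    using coeff_weight'[OF G(2)] G(1) unfolding V_def R_def by blast
qed

lemma poly_map_poly_mod:
  "poly (map_poly (\<lambda>g. smult a (g mod R)) G) [:c:] = smult a (poly G [:c:] mod (R::complex poly))"
proof (induction G)
  case (pCons g G)
  then show ?case
    by (simp add: map_poly_pCons poly_mod_add_left mod_smult_left smult_add_right mult.commute)
qed simp

text \<open>
  If \<open>r\<close> divides \<open>G(c)\<close>, then reducing the coefficients of \<open>G\<close> modulo \<open>r\<close> and clearing denominators gives a
  polynomial that vanishes at \<open>c\<close>, hence is zero: \<open>r\<close> divides every coefficient of \<open>G\<close>.  Any nonzero
  coefficient will do.
\<close>

lemma eliminate_transcendental:
  assumes transcendental: "\<And>m H. lift (poly_weight cs) m H \<Longrightarrow> poly m [:c:] = 0 \<Longrightarrow> m = 0"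
    and r: "r \<noteq> 0" and G: "lift (poly_weight cs) G W" "poly G [:c:] \<noteq> 0"
    and dvd: "complex_poly r dvd poly G [:c:]"
  shows "\<exists>p. poly_weight cs p W \<and> p \<noteq> 0 \<and> complex_poly r dvd p"
proof -
  interpret weighting "poly_weight cs" by (rule weighting_poly_weight)
  define R where "R = complex_poly r"
  have "\<exists>a. a \<noteq> 0 \<and> (\<exists>H. poly_weight cs (smult (of_int a) (coeff G i mod R)) H)" for i
    unfolding R_def using poly_weight_mod[OF r coeff_weight'[OF G(1)]] .
  then obtain a where a: "\<And>i. a i \<noteq> 0"
    "\<And>i. \<exists>H. poly_weight cs (smult (of_int (a i)) (coeff G i mod R)) H"
    by metis
  \<comment> \<open>A common denominator, so that a single factor serves all coefficients.\<close>
  define A where "A = (\<Prod>i\<le>degree G. a i)"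
  have A: "A \<noteq> 0" using a(1) by (simp add: A_def)
  define G' where "G' = map_poly (\<lambda>g. smult (of_int A) (g mod R)) G"
  have coeff_G': "coeff G' i = smult (of_int A) (coeff G i mod R)" for i
    by (simp add: G'_def coeff_map_poly)
  have "\<exists>H. poly_weight cs (coeff G' i) H" for i
  proof (cases "i \<le> degree G")
    case True
    then have "a i dvd A" unfolding A_def by (intro dvd_prodI) auto
    then obtain b where "A = b * a i" by (metis dvdE mult.commute)
    then show ?thesis
      using poly_weight_smult_int[OF a(2)[of i], of b] by (simp add: coeff_G')
  next
    case False
    then show ?thesis using zero by (auto simp: coeff_G' coeff_eq_0)
  qed
  then obtain H where "lift (poly_weight cs) G' H" using lift_exI by blast
  moreover have "poly G' [:c:] = 0"
    using dvd by (simp add: G'_def poly_map_poly_mod R_def mod_eq_0_iff_dvd)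
  ultimately have "G' = 0" by (rule transcendental)
  then have "R dvd coeff G i" for i
    using coeff_G'[of i] A by (simp add: mod_eq_0_iff_dvd)
  moreover obtain i where "coeff G i \<noteq> 0"
    using G(2) by (metis leading_coeff_0_iff poly_0)
  ultimately show ?thesis using coeff_weight'[OF G(1)] R_def by blast
qed

text \<open>
  Euclidean descent on the degree of \<open>G\<close>.  If \<open>R\<close> is the pseudo-remainder of \<open>m\<close> by \<open>G\<close>, then \<open>R(c)\<close> is a
  multiple of \<open>G(c)\<close>, since \<open>m(c) = 0\<close>.  The polynomial \<open>R\<close> is not zero: otherwise \<open>G\<close> would be
  a factor of a multiple of \<open>m\<close>, and the cofactor, of degree less than that of \<open>m\<close>, would vanish at \<open>c\<close>.
  There are at most \<open>degree m\<close> steps, and each raises the weight to a power that depends on \<open>m\<close> only.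
\<close>

lemma poly_weight_descent:
  assumes m: "lift (poly_weight cs) m h" "m \<noteq> 0" "poly m [:c:] = 0"
    and minimal: "\<And>m' H. lift (poly_weight cs) m' H \<Longrightarrow> poly m' [:c:] = 0 \<Longrightarrow>
      degree m' < degree m \<Longrightarrow> m' = 0"
  shows "e < degree m \<Longrightarrow> \<exists>K. \<forall>G W. lift (poly_weight cs) G W \<longrightarrow> G \<noteq> 0 \<longrightarrow> degree G \<le> e \<longrightarrow> W \<ge> 2 \<longrightarrow>
    (\<exists>p. poly_weight cs p (W ^ K) \<and> p \<noteq> 0 \<and> poly G [:c:] dvd p)"
proof (induction e)
  case 0
  interpret weighting "poly_weight cs" by (rule weighting_poly_weight)
  have "\<exists>p. poly_weight cs p (W ^ 1) \<and> p \<noteq> 0 \<and> poly G [:c:] dvd p"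
    if G: "lift (poly_weight cs) G W" "G \<noteq> 0" "degree G \<le> 0" for G W
  proof -
    obtain g where "G = [:g:]" using G(3) by (auto elim: degree_eq_zeroE)
    then show ?thesis using coeff_weight'[OF G(1), of 0] G(2) by auto
  qed
  then show ?case by blast
next
  case (Suc e)
  interpret weighting "poly_weight cs" by (rule weighting_poly_weight)
  interpret L: weighting "lift (poly_weight cs)" by (rule weighting_lift)
  obtain K where K: "\<And>G W. lift (poly_weight cs) G W \<Longrightarrow> G \<noteq> 0 \<Longrightarrow> degree G \<le> e \<Longrightarrow> W \<ge> 2 \<Longrightarrow>
    (\<exists>p. poly_weight cs p (W ^ K) \<and> p \<noteq> 0 \<and> poly G [:c:] dvd p)"
    using Suc by auto
  define N where "N = h + 2 * Suc (degree m)"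
  have "\<exists>p. poly_weight cs p (W ^ (N * K)) \<and> p \<noteq> 0 \<and> poly G [:c:] dvd p"
    if G: "lift (poly_weight cs) G W" "G \<noteq> 0" "degree G \<le> Suc e" "W \<ge> 2" for G W
  proof (cases "degree G \<le> e")
    case True
    have "W ^ K \<le> W ^ (N * K)"
      using G(4) by (intro power_increasing) (auto simp: N_def)
    then show ?thesis using K[OF G(1,2) True G(4)] mono by blast
  next
    case False
    then have deg: "degree G > 0" "degree G < degree m" using G(3) Suc.prems by auto
    have nz: "poly G [:c:] \<noteq> 0" using minimal[OF G(1)] deg(2) G(2) by blast
    obtain k Q R HQ where R: "smult (lead_coeff G ^ k) m = Q * G + R" "degree R < degree G"
      "lift (poly_weight cs) Q HQ" "lift (poly_weight cs) R (h * (2 * W) ^ Suc (degree m))"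
      using pseudo_remainder[OF G(1) deg(1) m(1)] by blast
    have "poly (Q * G + R) [:c:] = 0"
      unfolding R(1)[symmetric] by (simp add: m(3))
    then have at_c: "poly R [:c:] = - (poly Q [:c:] * poly G [:c:])"
      by (simp add: eq_neg_iff_add_eq_0 add.commute)
    have "R \<noteq> 0"
    proof
      assume "R = 0"
      then have eq: "smult (lead_coeff G ^ k) m = Q * G" using R(1) by simp
      have "smult (lead_coeff G ^ k) m \<noteq> 0" using m(2) G(2) by simp
      then have "Q \<noteq> 0" unfolding eq by auto
      moreover have "degree m = degree Q + degree G"
        using arg_cong[OF eq, of degree] \<open>Q \<noteq> 0\<close> G(2) by (simp add: degree_mult_eq)
      moreover have "poly Q [:c:] = 0" using at_c nz \<open>R = 0\<close> by simp
      ultimately show False using minimal[OF R(3)] deg(1) by auto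
    qed
    have "h \<le> W ^ h"
      using G(4) by (meson less_exp less_imp_le order.trans power_mono zero_le)
    moreover have "2 * W \<le> W ^ 2" using G(4) by (simp add: power2_eq_square)
    then have "(2 * W) ^ Suc (degree m) \<le> (W ^ 2) ^ Suc (degree m)" by (rule power_mono) simp
    ultimately have "h * (2 * W) ^ Suc (degree m) \<le> W ^ h * (W ^ 2) ^ Suc (degree m)"
      by (rule mult_le_mono)
    also have "\<dots> = W ^ N" by (simp only: N_def power_add power_mult)
    finally have "lift (poly_weight cs) R (W ^ N)" using L.mono R(4) by blast
    moreover have "W \<le> W ^ N"
      using G(4) by (intro self_le_power) (auto simp: N_def)
    then have "2 \<le> W ^ N" using G(4) by linarith
    ultimately obtain p where "poly_weight cs p ((W ^ N) ^ K)" "p \<noteq> 0" "poly R [:c:] dvd p"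
      using K[of R "W ^ N"] \<open>R \<noteq> 0\<close> R(2) G(3) by auto
    moreover have "poly G [:c:] dvd poly R [:c:]" unfolding at_c by simp
    ultimately show ?thesis by (metis dvd_trans power_mult)
  qed
  then show ?case by blast
qed

lemma eliminate_algebraic:
  assumes alg: "lift (poly_weight cs) m0 h0" "poly m0 [:c:] = 0" "m0 \<noteq> 0"
  shows "\<exists>K. \<forall>G W. lift (poly_weight cs) G W \<longrightarrow> poly G [:c:] \<noteq> 0 \<longrightarrow> W \<ge> 2 \<longrightarrow>
    (\<exists>p. poly_weight cs p (W ^ K) \<and> p \<noteq> 0 \<and> poly G [:c:] dvd p)"
proof -
  interpret weighting "poly_weight cs" by (rule weighting_poly_weight)
  interpret L: weighting "lift (poly_weight cs)" by (rule weighting_lift)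
  define A where "A m \<longleftrightarrow> m \<noteq> 0 \<and> poly m [:c:] = 0 \<and> (\<exists>h. lift (poly_weight cs) m h)" for m
  have "A m0" using alg by (auto simp: A_def)
  then obtain m where m: "A m" "\<And>m'. A m' \<Longrightarrow> degree m \<le> degree m'"
    using ex_has_least_nat[of A m0 degree] by blast
  then obtain h where h: "lift (poly_weight cs) m h" "m \<noteq> 0" "poly m [:c:] = 0"
    by (auto simp: A_def)
  have minimal: "m' = 0"
    if "lift (poly_weight cs) m' H" "poly m' [:c:] = 0" "degree m' < degree m" for m' H
    using that m(2)[of m'] by (auto simp: A_def)
  have deg: "degree m > 0"
    using h(2,3) by (metis degree_eq_zeroE gr0I pCons_0_0 poly_const_conv)
  have "\<exists>K. \<forall>G W. lift (poly_weight cs) G W \<longrightarrow> G \<noteq> 0 \<longrightarrow> degree G \<le> degree m - 1 \<longrightarrow> W \<ge> 2 \<longrightarrow>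
    (\<exists>p. poly_weight cs p (W ^ K) \<and> p \<noteq> 0 \<and> poly G [:c:] dvd p)"
    by (rule poly_weight_descent[OF h]) (use minimal deg in auto)
  then obtain K where
    K: "\<And>G W. lift (poly_weight cs) G W \<Longrightarrow> G \<noteq> 0 \<Longrightarrow> degree G \<le> degree m - 1 \<Longrightarrow> W \<ge> 2 \<Longrightarrow>
    (\<exists>p. poly_weight cs p (W ^ K) \<and> p \<noteq> 0 \<and> poly G [:c:] dvd p)"
    by blast
  \<comment> \<open>First reduce \<open>G\<close> modulo \<open>m\<close>; the number of steps is at most logarithmic in \<open>W\<close>,
      since \<open>2 ^ degree G \<le> W\<close>, so that the weight is again raised to a fixed power.\<close>
  define N where "N = 1 + 4 * h"
  have "\<exists>p. poly_weight cs p (W ^ (N * K)) \<and> p \<noteq> 0 \<and> poly G [:c:] dvd p"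
    if G: "lift (poly_weight cs) G W" "poly G [:c:] \<noteq> 0" "W \<ge> 2" for G W
  proof -
    obtain k Q R HQ where R: "smult (lead_coeff m ^ k) G = Q * m + R" "degree R < degree m"
      "lift (poly_weight cs) R (W * (2 * h) ^ Suc (degree G))"
      using pseudo_remainder[OF h(1) deg G(1)] by blast
    have at_c: "poly R [:c:] = lead_coeff m ^ k * poly G [:c:]"
      using arg_cong[OF R(1), of "\<lambda>u. poly u [:c:]"] by (simp add: h(3))
    then have "R \<noteq> 0" using G(2) h(2) by auto
    have "G \<noteq> 0" using G(2) by auto
    then have degW: "2 ^ degree G \<le> W" by (rule degree_weight[OF G(1)])
    have "2 ^ Suc (degree G) \<le> W ^ 2"
      using mult_le_mono[OF G(3) degW] by (simp add: power2_eq_square)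
    then have "(2 ^ Suc (degree G)) ^ (2 * h) \<le> (W ^ 2) ^ (2 * h)" by (rule power_mono) simp
    moreover have "(2 * h) ^ Suc (degree G) \<le> (2 ^ (2 * h)) ^ Suc (degree G)"
      by (rule power_mono[OF less_imp_le[OF less_exp]]) simp
    moreover have "((2::nat) ^ (2 * h)) ^ Suc (degree G) = (2 ^ Suc (degree G)) ^ (2 * h)"
      by (metis mult.commute power_mult)
    moreover have "(W ^ 2) ^ (2 * h) = W ^ (4 * h)" by (simp flip: power_mult)
    ultimately have "(2 * h) ^ Suc (degree G) \<le> W ^ (4 * h)" by linarith
    then have "W * (2 * h) ^ Suc (degree G) \<le> W * W ^ (4 * h)" by (rule mult_le_mono2)
    also have "\<dots> = W ^ N" by (simp add: N_def)
    finally have "lift (poly_weight cs) R (W ^ N)" using L.mono R(3) by blast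
    moreover have "W \<le> W ^ N"
      using G(3) by (intro self_le_power) (auto simp: N_def)
    then have "2 \<le> W ^ N" using G(3) by linarith
    moreover have "degree R \<le> degree m - 1" using R(2) by simp
    ultimately obtain p where "poly_weight cs p ((W ^ N) ^ K)" "p \<noteq> 0" "poly R [:c:] dvd p"
      using K[of R "W ^ N"] \<open>R \<noteq> 0\<close> by blast
    moreover have "poly G [:c:] dvd poly R [:c:]" unfolding at_c by simp
    ultimately show ?thesis by (metis dvd_trans power_mult)
  qed
  then show ?thesis by blast
qed

lemma eliminate_constants:
  "\<exists>K. \<forall>r f W. r \<noteq> 0 \<longrightarrow> poly_weight cs f W \<longrightarrow> f \<noteq> 0 \<longrightarrow> complex_poly r dvd f \<longrightarrow> W \<ge> 2 \<longrightarrow>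
    (\<exists>p. poly_weight [] p (W ^ K) \<and> p \<noteq> 0 \<and> complex_poly r dvd p)"
proof (induction cs)
  case Nil
  show ?case by (intro exI[of _ 1]) (metis power_one_right)
next
  case (Cons c cs)
  then obtain K where K: "\<And>r f W. r \<noteq> 0 \<Longrightarrow> poly_weight cs f W \<Longrightarrow> f \<noteq> 0 \<Longrightarrow> complex_poly r dvd f
    \<Longrightarrow> W \<ge> 2 \<Longrightarrow> (\<exists>p. poly_weight [] p (W ^ K) \<and> p \<noteq> 0 \<and> complex_poly r dvd p)"
    by blast
  have "\<exists>L. \<forall>r f W. r \<noteq> 0 \<longrightarrow> poly_weight (c # cs) f W \<longrightarrow> f \<noteq> 0 \<longrightarrow> complex_poly r dvd f \<longrightarrow> W \<ge> 2
    \<longrightarrow> (\<exists>p. poly_weight cs p (W ^ L) \<and> p \<noteq> 0 \<and> complex_poly r dvd p)"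
  proof (cases "\<exists>m H. lift (poly_weight cs) m H \<and> poly m [:c:] = 0 \<and> m \<noteq> 0")
    case True
    then obtain L where "\<And>G W. lift (poly_weight cs) G W \<Longrightarrow> poly G [:c:] \<noteq> 0 \<Longrightarrow> W \<ge> 2 \<Longrightarrow>
      (\<exists>p. poly_weight cs p (W ^ L) \<and> p \<noteq> 0 \<and> poly G [:c:] dvd p)"
      using eliminate_algebraic by meson
    then show ?thesis by (intro exI[of _ L]) (auto, meson dvd_trans)
  next
    case False
    then have "\<exists>p. poly_weight cs p W \<and> p \<noteq> 0 \<and> complex_poly r dvd p"
      if f: "r \<noteq> 0" "poly_weight (c # cs) f W" "f \<noteq> 0" "complex_poly r dvd f" for r f W
    proof -
      obtain G where G: "poly G [:c:] = f" "lift (poly_weight cs) G W" using f(2) by auto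
      show ?thesis
        by (rule eliminate_transcendental[OF _ f(1) G(2)]) (use False f G(1) in auto)
    qed
    then show ?thesis by (intro exI[of _ 1]) (metis power_one_right)
  qed
  then obtain L where L: "\<And>r f W. r \<noteq> 0 \<Longrightarrow> poly_weight (c # cs) f W \<Longrightarrow> f \<noteq> 0 \<Longrightarrow>
    complex_poly r dvd f \<Longrightarrow> W \<ge> 2 \<Longrightarrow>
    (\<exists>p. poly_weight cs p (W ^ L) \<and> p \<noteq> 0 \<and> complex_poly r dvd p)" by blast
  \<comment> \<open>The exponent \<open>Suc L\<close> instead of \<open>L\<close> keeps the weight at least 2 when \<open>L = 0\<close>.\<close>
  have "\<exists>p. poly_weight [] p (W ^ (Suc L * K)) \<and> p \<noteq> 0 \<and> complex_poly r dvd p"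
    if H: "r \<noteq> 0" "poly_weight (c # cs) f W" "f \<noteq> 0" "complex_poly r dvd f" "W \<ge> 2" for r f W
  proof -
    interpret weighting "poly_weight cs" by (rule weighting_poly_weight)
    obtain p where p: "poly_weight cs p (W ^ L)" "p \<noteq> 0" "complex_poly r dvd p"
      using L[OF H] by blast
    have "W ^ L \<le> W ^ Suc L" using H(5) by (intro power_increasing) auto
    then have "poly_weight cs p (W ^ Suc L)" using mono p(1) by blast
    moreover have "W \<le> W ^ Suc L" using H(5) by (intro self_le_power) auto
    then have "2 \<le> W ^ Suc L" using H(5) by linarith
    ultimately show ?thesis using K[OF H(1) _ p(2,3)] by (metis power_mult)
  qed
  then show ?case by blast
qed

section \<open>Integer multiples of the polynomials \<open>q\<close>\<close>

text \<open>Gauss' lemma, for divisibility over the complex numbers.\<close>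

lemma dvd_of_complex_poly_dvd:
  assumes r: "content r = 1" and dvd: "complex_poly r dvd complex_poly g"
  shows "r dvd g"
proof -
  have "r \<noteq> 0" using r by auto
  then obtain a u where a: "a \<noteq> 0" "smult a g = r * u + pseudo_mod g r"
    using pseudo_mod(1) by blast
  have deg: "pseudo_mod g r = 0 \<or> degree (pseudo_mod g r) < degree r"
    using pseudo_mod(2)[OF \<open>r \<noteq> 0\<close>] .
  have "complex_poly (pseudo_mod g r) = smult (of_int a) (complex_poly g) - complex_poly r * complex_poly u"
    using arg_cong[OF a(2), of complex_poly]
    by (simp add: complex_poly_smult complex_poly_add complex_poly_mult)
  then have "complex_poly r dvd complex_poly (pseudo_mod g r)"
    using dvd by (simp add: dvd_smult)
  then have "degree r \<le> degree (pseudo_mod g r)" if "pseudo_mod g r \<noteq> 0"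
    using that dvd_imp_degree_le[of "complex_poly r" "complex_poly (pseudo_mod g r)"]
    by (simp add: complex_poly_0_iff degree_complex_poly)
  then have "pseudo_mod g r = 0" using deg by fastforce
  then have eq: "smult a g = r * u" using a(2) by simp
  have "content u = normalize a * content g"
    using arg_cong[OF eq, of content] r by (simp add: content_mult)
  then have "a dvd content u" by simp
  then obtain b where b: "content u = a * b" by (elim dvdE)
  have "smult a g = r * smult (content u) (primitive_part u)"
    using eq by simp
  also have "\<dots> = smult a (r * smult b (primitive_part u))" by (simp add: b)
  finally have "smult a (g - r * smult b (primitive_part u)) = 0"
    by (simp only: smult_diff_right diff_self)
  then have "g = r * smult b (primitive_part u)" using a(1) by simp
  then show ?thesis by (rule dvdI)
qed

text \<open>
  All coefficients of \<open>q d\<close> are even and the constant one is 2, so half of \<open>q d\<close> is a primitive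
  integer polynomial.
\<close>

definition half_q :: "nat \<Rightarrow> int poly" where
  "half_q d = (\<Sum>i=0..d. monom (2 ^ (2 ^ i - 1)) i)"

lemma coeff_half_q: "coeff (half_q d) i = (if i \<le> d then 2 ^ (2 ^ i - 1) else 0)"
proof -
  have "coeff (half_q d) i = (\<Sum>j=0..d. if j = i then 2 ^ (2 ^ i - 1) else 0)"
    unfolding half_q_def coeff_sum by (intro sum.cong) auto
  then show ?thesis by simp
qed

lemma degree_half_q: "degree (half_q d) = d"
  by (intro antisym degree_le le_degree) (auto simp: coeff_half_q)

lemma content_half_q: "content (half_q d) = 1"
proof -
  have "coeff (half_q d) 0 = 1" by (simp add: coeff_half_q)
  then have "content (half_q d) dvd 1" by (metis content_dvd_coeff)
  then show ?thesis by (simp only: is_unit_content_iff)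
qed

lemma q_eq_half_q: "q d = smult 2 (complex_poly (half_q d))"
proof (rule poly_eqI)
  fix i
  have "coeff (q d) i = (\<Sum>j=0..d. if j = i then 2 ^ (2 ^ i) else 0)"
    unfolding q_def coeff_sum by (intro sum.cong) auto
  moreover have "(2::complex) ^ (2 ^ i) = 2 * 2 ^ (2 ^ i - 1)"
    by (simp flip: power_Suc)
  ultimately show "coeff (q d) i = coeff (smult 2 (complex_poly (half_q d))) i"
    by (simp add: coeff_map_poly coeff_half_q)
qed

lemma integer_multiple_weight:
  assumes "poly_weight [] p W" "p \<noteq> 0" "complex_poly (half_q d) dvd p"
  shows "2 ^ (2 ^ d - 1) \<le> W"
proof -
  obtain g where g: "p = complex_poly g" "\<And>i. \<bar>coeff g i\<bar> \<le> int W"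
    using poly_weight_Nil_obtain[OF assms(1)] by blast
  have "half_q d dvd g"
    using dvd_of_complex_poly_dvd[OF content_half_q] assms(3) g(1) by simp
  then obtain u where u: "g = half_q d * u" by (elim dvdE)
  then have "lead_coeff (half_q d) dvd lead_coeff g" by (simp add: lead_coeff_mult)
  moreover have "lead_coeff g \<noteq> 0" using assms(2) g(1) by auto
  ultimately have "lead_coeff (half_q d) \<le> \<bar>lead_coeff g\<bar>"
    using dvd_imp_le_int[of "lead_coeff g"] by fastforce
  moreover have "lead_coeff (half_q d) = 2 ^ (2 ^ d - 1)"
    by (simp add: degree_half_q coeff_half_q)
  ultimately have "2 ^ (2 ^ d - 1) \<le> int W"
    using g(2)[of "degree g"] by linarith
  then show ?thesis by simp
qed

section \<open>Generic computation paths\<close>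

text \<open>
  The states \<open>s x\<close>, reached from the inputs \<open>x\<close> after equally many steps, are given by the same
  formulas for all \<open>x\<close> with \<open>F x \<noteq> 0\<close>: either the machine is at the same instruction and the
  cells hold quotients \<open>N i / D i\<close> of polynomials of weight at most \<open>H\<close>, or it has stopped in the same way.
\<close>

definition generic_state :: "complex list \<Rightarrow> complex poly \<Rightarrow> nat \<Rightarrow> (complex \<Rightarrow> state) \<Rightarrow> bool" where
  "generic_state cs F H s \<longleftrightarrow>
     (\<exists>pc N D. (\<forall>i. poly_weight cs (N i) H \<and> poly_weight cs (D i) H) \<and>
        (\<forall>x. poly F x \<noteq> 0 \<longrightarrow> (\<forall>i. poly (D i) x \<noteq> 0) \<and>
           s x = Running pc (\<lambda>i. poly (N i) x / poly (D i) x))) \<or>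
     (\<exists>b. \<forall>x. poly F x \<noteq> 0 \<longrightarrow> s x = Halted b) \<or>
     (\<forall>x. poly F x \<noteq> 0 \<longrightarrow> s x = Failed)"

text \<open>The complex numbers that a machine can load.\<close>

fun instr_constants :: "instr \<Rightarrow> complex list" where
  "instr_constants (Load i c) = [c]"
| "instr_constants _ = []"

definition constants :: "machine \<Rightarrow> complex list" where
  "constants M = concat (map instr_constants M)"

text \<open>
  One step forms at most a sum of two products of numerators and denominators, of weight
  \<open>2 * H * H\<close>.  The polynomial \<open>F\<close> acquires a new factor only if a nonzero numerator is tested or divided by.
\<close>

lemma generic_state_step:
  assumes M: "set (constants M) \<subseteq> set cs" and H: "H \<ge> 2"
    and F: "F \<noteq> 0" "poly_weight cs F HF" and s: "generic_state cs F H s"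
  shows "\<exists>F'. F' \<noteq> 0 \<and> poly_weight cs F' (HF * H) \<and> generic_state cs F' (2 * H * H) (\<lambda>x. step M (s x))"
proof -
  interpret weighting "poly_weight cs" by (rule weighting_poly_weight)
  have FH: "poly_weight cs F (HF * H)" using mono[OF F(2)] H by simp
  have HH: "H \<le> 2 * H * H" using H by simp
  consider (Running) pc N D where "\<And>i. poly_weight cs (N i) H" "\<And>i. poly_weight cs (D i) H"
      "\<And>x i. poly F x \<noteq> 0 \<Longrightarrow> poly (D i) x \<noteq> 0"
      "\<And>x. poly F x \<noteq> 0 \<Longrightarrow> s x = Running pc (\<lambda>i. poly (N i) x / poly (D i) x)"
    | (Halted) b where "\<And>x. poly F x \<noteq> 0 \<Longrightarrow> s x = Halted b"
    | (Failed) "\<And>x. poly F x \<noteq> 0 \<Longrightarrow> s x = Failed"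
    using s unfolding generic_state_def by (elim disjE exE) (blast intro: that)+
  then show ?thesis
  proof cases
    case Halted
    then have "generic_state cs F (2 * H * H) (\<lambda>x. step M (s x))"
      unfolding generic_state_def by auto
    with F(1) FH show ?thesis by blast
  next
    case Failed
    then have "generic_state cs F (2 * H * H) (\<lambda>x. step M (s x))"
      unfolding generic_state_def by auto
    with F(1) FH show ?thesis by blast
  next
    case Running
    note N = Running(1) and D = Running(2) and Dx = Running(3) and sx = Running(4)
    have N': "poly_weight cs (N i) (2 * H * H)" and D': "poly_weight cs (D i) (2 * H * H)" for i
      using mono[OF N HH] mono[OF D HH] by auto
    have mult': "poly_weight cs (u * v) (2 * H * H)"
      if "poly_weight cs u H" "poly_weight cs v H" for u v
      using mono[OF mult[OF that]] by simp
    have moved: "generic_state cs F' (2 * H * H) (\<lambda>x. step M (s x))"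
      if "\<And>i. poly_weight cs (N' i) (2 * H * H)" "\<And>i. poly_weight cs (D' i) (2 * H * H)"
        "\<And>x i. poly F' x \<noteq> 0 \<Longrightarrow> poly (D' i) x \<noteq> 0"
        "\<And>x. poly F' x \<noteq> 0 \<Longrightarrow> step M (s x) = Running pc' (\<lambda>i. poly (N' i) x / poly (D' i) x)"
      for F' N' D' pc'
      unfolding generic_state_def using that by blast
    have written: "generic_state cs F' (2 * H * H) (\<lambda>x. step M (s x))"
      if "poly_weight cs n (2 * H * H)" "poly_weight cs d (2 * H * H)"
        "\<And>x. poly F' x \<noteq> 0 \<Longrightarrow> poly F x \<noteq> 0" "\<And>x. poly F' x \<noteq> 0 \<Longrightarrow> poly d x \<noteq> 0"
        "\<And>x. poly F' x \<noteq> 0 \<Longrightarrow> step M (s x)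
           = Running pc' ((\<lambda>i. poly (N i) x / poly (D i) x)(j := poly n x / poly d x))"
      for F' n d pc' j
      by (rule moved[of "N(j := n)" "D(j := d)" F' pc']) (use that N' D' Dx in auto)
    have failed: "generic_state cs F (2 * H * H) (\<lambda>x. step M (s x))"
      if "\<And>x. poly F x \<noteq> 0 \<Longrightarrow> step M (s x) = Failed"
      unfolding generic_state_def using that by blast
    have halted: "generic_state cs F (2 * H * H) (\<lambda>x. step M (s x))"
      if "\<And>x. poly F x \<noteq> 0 \<Longrightarrow> step M (s x) = Halted b" for b
      unfolding generic_state_def using that by blast
    have keep: ?thesis if "generic_state cs F (2 * H * H) (\<lambda>x. step M (s x))"
      using that F(1) FH by blast
    have avoid: ?thesis
      if "N k \<noteq> 0" "generic_state cs (F * N k) (2 * H * H) (\<lambda>x. step M (s x))" for k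
      using that F(1) mult[OF F(2) N] by (metis mult_eq_0_iff)
    show ?thesis
    proof (cases "pc < length M")
      case False
      then show ?thesis by (intro keep failed) (simp add: sx)
    next
      case pc: True
      show ?thesis
      proof (cases "M ! pc")
        case (Load i c)
        have "Load i c \<in> set M" using nth_mem[OF pc] Load by simp
        then have "c \<in> set (constants M)" unfolding constants_def by force
        then have c: "poly_weight cs [:c:] (2 * H * H)"
          using M H HH mono[OF poly_weight_constant] by (meson order.trans subsetD)
        show ?thesis
          by (intro keep written[OF c mono[OF one], where pc' = "Suc pc" and j = i]) (use pc Load sx H in auto)
      next
        case (Copy i j)
        show ?thesis
          by (intro keep written[OF N'[of j] D'[of j], where pc' = "Suc pc" and j = i]) (use pc Copy sx Dx in auto)
      next
        case (Add i j k)
        have "poly_weight cs (N j * D k + N k * D j) (2 * H * H)"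
          using add[OF mult[OF N[of j] D[of k]] mult[OF N[of k] D[of j]]]
          by (simp add: mult_2 distrib_right)
        then show ?thesis
          by (intro keep written[OF _ mult'[OF D[of j] D[of k]], where pc' = "Suc pc" and j = i])
            (use pc Add sx Dx in \<open>auto simp: add_frac_eq\<close>)
      next
        case (Sub i j k)
        have "poly_weight cs (N j * D k - N k * D j) (2 * H * H)"
          using diff[OF mult[OF N[of j] D[of k]] mult[OF N[of k] D[of j]]]
          by (simp add: mult_2 distrib_right)
        then show ?thesis
          by (intro keep written[OF _ mult'[OF D[of j] D[of k]], where pc' = "Suc pc" and j = i])
            (use pc Sub sx Dx in \<open>auto simp: diff_frac_eq\<close>)
      next
        case (Mul i j k)
        show ?thesis
          by (intro keep written[OF mult'[OF N[of j] N[of k]] mult'[OF D[of j] D[of k]], where pc' = "Suc pc" and j = i])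
            (use pc Mul sx Dx in auto)
      next
        case (Div i j k)
        show ?thesis
        proof (cases "N k = 0")
          case True
          then show ?thesis by (intro keep failed) (use pc Div sx in auto)
        next
          case False
          show ?thesis
            by (intro avoid[OF False] written[OF mult'[OF N[of j] D[of k]] mult'[OF D[of j] N[of k]],
                where pc' = "Suc pc" and j = i])
              (use pc Div sx Dx in auto)
        qed
      next
        case ShiftLeft
        show ?thesis
          by (intro keep moved[of "\<lambda>i. N (i + 1)" "\<lambda>i. D (i + 1)" F "Suc pc"])
            (use pc ShiftLeft sx Dx N' D' in auto)
      next
        case ShiftRight
        show ?thesis
          by (intro keep moved[of "\<lambda>i. N (i - 1)" "\<lambda>i. D (i - 1)" F "Suc pc"])
            (use pc ShiftRight sx Dx N' D' in auto)
      next
        case (BranchZero j l m)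
        show ?thesis
        proof (cases "N j = 0")
          case True
          then show ?thesis
            by (intro keep moved[of N D F l]) (use pc BranchZero sx Dx N' D' in auto)
        next
          case False
          show ?thesis
            by (intro avoid[OF False] moved[of N D _ m]) (use pc BranchZero sx Dx N' D' in auto)
        qed
      next
        case AnswerYes
        then show ?thesis by (intro keep halted[of True]) (use pc sx in auto)
      next
        case AnswerNo
        then show ?thesis by (intro keep halted[of False]) (use pc sx in auto)
      qed
    qed
  qed
qed

lemma set_binary_digits: "set (binary_digits n) \<subseteq> {0, 1}"
proof (induction n rule: less_induct)
  case (less n)
  show ?case
  proof (cases "n = 0")
    case False
    then have "set (binary_digits (n div 2)) \<subseteq> {0, 1}" by (intro less) auto
    with False show ?thesis by (subst binary_digits.simps) auto
  qed (simp add: binary_digits.simps)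
qed

lemma input_tape_poly:
  "\<exists>N. poly_weight cs N 2 \<and> (\<forall>x. input_tape (encode d x) i = poly N x)"
proof -
  interpret weighting "poly_weight cs" by (rule weighting_poly_weight)
  have zero': "poly_weight cs 0 2" and one': "poly_weight cs 1 2"
    using mono[OF zero] mono[OF one] by auto
  define L where "L = length (binary_digits d)"
  consider "1 \<le> i" "i \<le> int L" | "i = int L + 1" | "- int L \<le> i" "i \<le> 0"
    | "i < - int L" | "i > int L + 1" by linarith
  then show ?thesis
  proof cases
    case 1
    then have less: "nat (i - 1) < L" by auto
    then have "binary_digits d ! nat (i - 1) \<in> {0, 1}"
      using set_binary_digits nth_mem unfolding L_def by blast
    moreover have "input_tape (encode d x) i = of_nat (binary_digits d ! nat (i - 1))" for x
      using 1 less by (simp add: input_tape_def encode_def nth_append L_def)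
    ultimately show ?thesis using zero' one' by (metis insertE of_nat_0 of_nat_1 poly_0 poly_1 singletonD)
  next
    case 2
    then have "input_tape (encode d x) i = x" for x
      by (simp add: input_tape_def encode_def nth_append L_def)
    then show ?thesis using poly_weight_X by (intro exI[of _ "[:0, 1:]"]) auto
  next
    case 3
    then have "input_tape (encode d x) i = 1" for x
      by (simp add: input_tape_def encode_def L_def)
    then show ?thesis using one' by (intro exI[of _ 1]) auto
  next
    case 4
    then have "input_tape (encode d x) i = 0" for x
      by (simp add: input_tape_def encode_def L_def)
    then show ?thesis using zero' by (intro exI[of _ 0]) auto
  next
    case 5
    then have "input_tape (encode d x) i = 0" for x
      by (simp add: input_tape_def encode_def L_def)
    then show ?thesis using zero' by (intro exI[of _ 0]) auto
  qed
qed

text \<open>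
  The bounds solve the recursion \<open>H \<mapsto> 2 * H * H\<close>, starting with 2; the weight of \<open>F\<close> is
  at most the product of the successive values of \<open>H\<close>.
\<close>

lemma generic_run:
  "\<exists>F. F \<noteq> 0 \<and> poly_weight (constants M) F (2 ^ (2 ^ Suc n)) \<and>
     generic_state (constants M) F (2 ^ (2 ^ Suc n - 1)) (\<lambda>x. run M (encode d x) n)"
proof (induction n)
  case 0
  interpret weighting "poly_weight (constants M)" by (rule weighting_poly_weight)
  obtain N where N: "\<And>i. poly_weight (constants M) (N i) 2"
    "\<And>i x. input_tape (encode d x) i = poly (N i) x"
    using input_tape_poly[of "constants M" d] by metis
  have "generic_state (constants M) 1 2 (\<lambda>x. run M (encode d x) 0)"
    unfolding generic_state_def
    using N mono[OF one, of 2]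
    by (intro disjI1 exI[of _ 0] exI[of _ N] exI[of _ "\<lambda>_. 1"]) (auto simp: run_def fun_eq_iff)
  then show ?case using mono[OF one] by (intro exI[of _ 1]) auto
next
  case (Suc n)
  define H :: nat where "H = 2 ^ (2 ^ Suc n - 1)"
  have H2: "2 * H = 2 ^ (2 ^ Suc n)"
    unfolding H_def by (simp flip: power_Suc)
  have "(2::nat) ^ (2 ^ Suc (Suc n)) = (2 * H) * (2 * H)"
    unfolding H2 by (simp flip: power_add)
  moreover have "(2::nat) ^ (2 ^ Suc (Suc n)) = 2 * 2 ^ (2 ^ Suc (Suc n) - 1)"
    by (simp flip: power_Suc)
  ultimately have HH: "2 * H * H = 2 ^ (2 ^ Suc (Suc n) - 1)" by simp
  have "2 ^ 2 \<le> 2 * H" unfolding H2 by (intro power_increasing) auto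
  then have H: "H \<ge> 2" by simp
  interpret weighting "poly_weight (constants M)" by (rule weighting_poly_weight)
  obtain F where F: "F \<noteq> 0" "poly_weight (constants M) F (2 ^ (2 ^ Suc n))"
    "generic_state (constants M) F H (\<lambda>x. run M (encode d x) n)"
    using Suc.IH H_def by blast
  obtain F' where F': "F' \<noteq> 0" "poly_weight (constants M) F' (2 ^ (2 ^ Suc n) * H)"
    "generic_state (constants M) F' (2 * H * H) (\<lambda>x. step M (run M (encode d x) n))"
    using generic_state_step[OF order.refl H F] by blast
  have "2 ^ (2 ^ Suc n) * H \<le> 2 ^ (2 ^ Suc n) * (2 * H)" by simp
  also have "\<dots> = 2 ^ (2 ^ Suc (Suc n))" unfolding H2 by (simp flip: power_add)
  finally have "poly_weight (constants M) F' (2 ^ (2 ^ Suc (Suc n)))"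
    using mono[OF F'(2)] by blast
  moreover have "(\<lambda>x. step M (run M (encode d x) n)) = (\<lambda>x. run M (encode d x) (Suc n))"
    by (simp add: run_def)
  ultimately show ?case using F'(1,3) HH by metis
qed

lemma run_Halted_mono:
  assumes "run M w n = Halted b" "n \<le> n'"
  shows "run M w n' = Halted b"
  using assms(2,1)
  by (induction n' rule: dec_induct) (auto simp: run_def)

lemma decision_multiple:
  assumes run: "\<And>x. run M (encode d x) T = Halted (poly (q d) x = 0)"
  shows "\<exists>F. F \<noteq> 0 \<and> poly_weight (constants M) F ((2 ^ (2 ^ Suc T)) ^ d) \<and>
    complex_poly (half_q d) dvd F"
proof -
  interpret weighting "poly_weight (constants M)" by (rule weighting_poly_weight)
  obtain F where F: "F \<noteq> 0" "poly_weight (constants M) F (2 ^ (2 ^ Suc T))"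
    "generic_state (constants M) F (2 ^ (2 ^ Suc T - 1)) (\<lambda>x. run M (encode d x) T)"
    using generic_run by blast
  have "q d \<noteq> 0"
    using content_half_q[of d] by (auto simp: q_eq_half_q complex_poly_0_iff)
  then have "F * q d \<noteq> 0" using F(1) by simp
  then have "finite {x. poly (F * q d) x = 0}" by (rule poly_roots_finite)
  \<comment> \<open>At this point the generic path is followed and the answer is NO.\<close>
  then obtain y where "y \<notin> {x. poly (F * q d) x = 0}"
    using ex_new_if_finite infinite_UNIV_char_0 by blast
  then have y: "poly F y \<noteq> 0" "poly (q d) y \<noteq> 0" by auto
  have "poly F x = 0" if "poly (q d) x = 0" for x
  proof (rule ccontr)
    assume "poly F x \<noteq> 0"
    with F(3) y(1) have "run M (encode d x) T = run M (encode d y) T"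
      unfolding generic_state_def using run by (metis state.distinct(1,3,5))
    then show False using run y(2) that by simp
  qed
  then have "q d dvd F ^ degree (q d)"
    using nullstellensatz_univariate[of "q d" F] \<open>q d \<noteq> 0\<close> by blast
  then have "complex_poly (half_q d) dvd F ^ d"
    by (simp add: q_eq_half_q degree_complex_poly degree_half_q smult_dvd_iff)
  then show ?thesis using F(1) power[OF F(2)] by (intro exI[of _ "F ^ d"]) auto
qed

section \<open>The lower bound\<close>

lemma running_time_lower_bound:
  "\<exists>K. \<forall>d T. d \<ge> 2 \<longrightarrow> (\<forall>x. run M (encode d x) T = Halted (poly (q d) x = 0)) \<longrightarrow>
     2 ^ d - 1 \<le> 2 ^ Suc T * d * (K::nat)"
proof -
  obtain K where K: "\<And>r f W. r \<noteq> 0 \<Longrightarrow> poly_weight (constants M) f W \<Longrightarrow> f \<noteq> 0 \<Longrightarrow>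
    complex_poly r dvd f \<Longrightarrow> W \<ge> 2 \<Longrightarrow>
    (\<exists>p. poly_weight [] p (W ^ K) \<and> p \<noteq> 0 \<and> complex_poly r dvd p)"
    using eliminate_constants by blast
  have "2 ^ d - 1 \<le> 2 ^ Suc T * d * K"
    if d: "d \<ge> 2" and run: "\<And>x. run M (encode d x) T = Halted (poly (q d) x = 0)" for d T
  proof -
    define W :: nat where "W = (2 ^ (2 ^ Suc T)) ^ d"
    obtain F where F: "F \<noteq> 0" "poly_weight (constants M) F W" "complex_poly (half_q d) dvd F"
      using decision_multiple[OF run] W_def by blast
    have "half_q d \<noteq> 0" using content_half_q[of d] by auto
    moreover have "2 ^ 1 \<le> W"
      unfolding W_def power_mult[symmetric] by (rule power_increasing) (use d in auto)
    ultimately obtain p where "poly_weight [] p (W ^ K)" "p \<noteq> 0" "complex_poly (half_q d) dvd p"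
      using K F by (metis power_one_right)
    then have "2 ^ (2 ^ d - 1) \<le> W ^ K" by (rule integer_multiple_weight)
    also have "W ^ K = 2 ^ (2 ^ Suc T * d * K)" by (simp only: W_def power_mult)
    finally show ?thesis by (simp only: power_increasing_iff one_less_numeral_iff semiring_norm)
  qed
  then show ?thesis by blast
qed

theorem mainTheorem3:
  shows "\<not> (\<exists>(a::real) (b::real) (M::machine). a > 0 \<and> b > 0 \<and>
            (\<forall>(d::nat) (x::complex). d \<ge> 2 \<longrightarrow>
               answers_in_time M (encode d x) ((d, x) \<in> zero_set) (a * ln (real d) powr b)))"
proof
  assume "\<exists>(a::real) (b::real) (M::machine). a > 0 \<and> b > 0 \<and>
            (\<forall>(d::nat) (x::complex). d \<ge> 2 \<longrightarrow>
               answers_in_time M (encode d x) ((d, x) \<in> zero_set) (a * ln (real d) powr b))"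
  then obtain a b :: real and M where ab: "a > 0" "b > 0"
    and M: "\<And>d x. d \<ge> 2 \<Longrightarrow> answers_in_time M (encode d x) ((d, x) \<in> zero_set) (a * ln (real d) powr b)"
    by blast
  obtain K where K: "\<And>d T. d \<ge> 2 \<Longrightarrow> (\<And>x. run M (encode d x) T = Halted (poly (q d) x = 0)) \<Longrightarrow>
    2 ^ d - 1 \<le> 2 ^ Suc T * d * K"
    using running_time_lower_bound by blast
  \<comment> \<open>Any factor below 1 could replace the one half.\<close>
  have "eventually (\<lambda>d::nat. a * ln (real d) powr b < real d / 2) at_top"
    using ab by real_asymp
  moreover have "eventually (\<lambda>d::nat. C * real d * 2 powr (real d / 2) < 2 ^ d - 1) at_top"
    if "C > 0" for C :: real
    using that by real_asymp
  from this[of "2 * (real K + 1)"]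
  have "eventually (\<lambda>d::nat. 2 * (real K + 1) * real d * 2 powr (real d / 2) < 2 ^ d - 1) at_top"
    by simp
  ultimately have "eventually (\<lambda>d::nat. d \<ge> 2 \<and> a * ln (real d) powr b < real d / 2 \<and>
      2 * (real K + 1) * real d * 2 powr (real d / 2) < 2 ^ d - 1) at_top"
    using eventually_ge_at_top[of 2] by eventually_elim simp
  then obtain d :: nat where d: "d \<ge> 2" "a * ln (real d) powr b < real d / 2"
    "2 * (real K + 1) * real d * 2 powr (real d / 2) < 2 ^ d - 1"
    using eventually_happens'[OF sequentially_bot] by blast
  define t where "t = a * ln (real d) powr b"
  define T where "T = nat \<lfloor>t\<rfloor>"
  have t: "t \<ge> 0" using ab(1) by (simp add: t_def)
  have "run M (encode d x) T = Halted (poly (q d) x = 0)" for x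
  proof -
    obtain n where n: "real n \<le> t" "run M (encode d x) n = Halted ((d, x) \<in> zero_set)"
      using M[OF d(1), of x] unfolding answers_in_time_def t_def by blast
    then have "n \<le> T" by (simp add: T_def le_nat_iff le_floor_iff)
    from run_Halted_mono[OF n(2) this] show ?thesis by (simp add: zero_set_def)
  qed
  from K[OF d(1) this] have "real (2 ^ d - 1) \<le> real (2 ^ Suc T * d * K)"
    by (simp only: of_nat_le_iff)
  then have "2 ^ d - 1 \<le> 2 * real K * real d * 2 powr real T"
    by (simp add: of_nat_diff powr_realpow algebra_simps)
  moreover have "real T \<le> real d / 2"
    using d(2) of_nat_floor[OF t] unfolding T_def t_def by linarith
  then have "2 * real K * real d * 2 powr real T \<le> 2 * (real K + 1) * real d * 2 powr (real d / 2)"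
    by (intro mult_mono powr_mono) auto
  ultimately show False using d(3) by linarith
qed

end
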